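(* Fix $n\ge 5$ and let $\mathcal{D}_n$ be the flip graph on ordered pairs of disjoint triangulations of a convex $n$-gon. Let $(X_t)_{t\ge0}$ be the Markov chain with $X_0$ an arbitrary vertex of $\mathcal{D}_n$ and, for $t>0$, $X_t$ chosen uniformly at random among the vertices of $\mathcal{D}_n$ adjacent to $X_{t-1}$. Then as $t\to\infty$, the distribution of $X_t$ converges in total variation distance to the uniform distribution on the vertices of $\mathcal{D}_n$.
   Context: Label the vertices of a convex $n$-gon by $1,\dots,n$. A triangulation is a maximal set of pairwise noncrossing diagonals; two triangulations are disjoint if they share no diagonal. If $(a,b)$ is a diagonal of a triangulation $T$, deleting it leaves a unique quadrilateral $(a,a',b,b')$; the flip of $T$ at $(a,b)$ replaces $(a,b)$ by $(a',b')$. For an ordered pair $(T_1,T_2)$ of disjoint triangulations and a diagonal $(a,b)\in T_i$ ($i\in\{1,2\}$), the flip at $(a,b)_i$ is: (a) flip $(a,b)$ in $T_i$, obtaining a new diagonal $(a',b')$; (b) if $(a',b')\in T_j$ with $j\ne i$, then also flip $(a',b')$ in $T_j$. The flip graph $\mathcal{D}_n$ is the undirected graph whose vertices are the ordered pairs of disjoint triangulations of the $n$-gon, two pairs being adjacent if one is obtained from the other by a flip (the result of a flip is again such a pair, and flips are reversible). *)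

theory Defs
  imports "HOL-Probability.Probability"
begin

section \<open>Triangulations of a convex polygon\<close>

text \<open>The vertices of the polygon are \<open>{1..n}\<close> in cyclic order, and a segment is the
  two-element set of its endpoints.\<close>

definition sides :: "nat \<Rightarrow> nat set set" where
  "sides n = insert {n, 1} {{i, i + 1} | i. 1 \<le> i \<and> i < n}"

definition diagonals :: "nat \<Rightarrow> nat set set" where
  "diagonals n = {{a, b} | a b. a \<in> {1..n} \<and> b \<in> {1..n} \<and> a \<noteq> b} - sides n"

text \<open>By convexity, two segments cross iff their endpoints strictly interleave.\<close>

definition crosses :: "nat set \<Rightarrow> nat set \<Rightarrow> bool" where
  "crosses d e \<longleftrightarrow> (\<exists>a b x y. d = {a, b} \<and> e = {x, y} \<and>
     (a < x \<and> x < b \<and> b < y \<or> x < a \<and> a < y \<and> y < b))"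

definition noncrossing :: "nat set set \<Rightarrow> bool" where
  "noncrossing S \<longleftrightarrow> pairwise (\<lambda>d e. \<not> crosses d e) S"

definition triangulation :: "nat \<Rightarrow> nat set set \<Rightarrow> bool" where
  "triangulation n T \<longleftrightarrow> T \<subseteq> diagonals n \<and> noncrossing T \<and>
     (\<forall>S. S \<subseteq> diagonals n \<and> noncrossing S \<and> T \<subseteq> S \<longrightarrow> S = T)"

text \<open>The quadrilateral with successive corners \<open>a, a', b, b'\<close> (in either orientation) is a
  face of the dissection \<open>S\<close>. The crossing condition fixes the cyclic order of the corners; when
  \<open>S\<close> is noncrossing and contains the inner sides of the quadrilateral, the only members of \<open>S\<close>
  that could meet its interior are its two diagonals.\<close>

definition quadrilateral :: "nat \<Rightarrow> nat set set \<Rightarrow> nat \<Rightarrow> nat \<Rightarrow> nat \<Rightarrow> nat \<Rightarrow> bool" where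
  "quadrilateral n S a a' b b' \<longleftrightarrow>
     crosses {a, b} {a', b'} \<and>
     {{a, a'}, {a', b}, {b, b'}, {b', a}} \<subseteq> S \<union> sides n \<and>
     {a, b} \<notin> S \<and> {a', b'} \<notin> S"

definition flipped_diagonal :: "nat \<Rightarrow> nat set set \<Rightarrow> nat set \<Rightarrow> nat set" where
  "flipped_diagonal n T d = (THE d'. \<exists>a a' b b'. d = {a, b} \<and> d' = {a', b'} \<and>
     quadrilateral n (T - {d}) a a' b b')"

definition flip :: "nat \<Rightarrow> nat set set \<Rightarrow> nat set \<Rightarrow> nat set set" where
  "flip n T d = insert (flipped_diagonal n T d) (T - {d})"


section \<open>The flip graph on ordered pairs of disjoint triangulations\<close>

type_synonym triangulation_pair = "nat set set \<times> nat set set"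

definition disjoint_pairs :: "nat \<Rightarrow> triangulation_pair set" where
  "disjoint_pairs n = {(T1, T2). triangulation n T1 \<and> triangulation n T2 \<and> T1 \<inter> T2 = {}}"

text \<open>The flip at \<open>d\<close> in \<open>T\<close>, together with the induced flip in the other triangulation \<open>U\<close>.\<close>

definition joint_flip :: "nat \<Rightarrow> nat set set \<Rightarrow> nat set set \<Rightarrow> nat set \<Rightarrow> triangulation_pair" where
  "joint_flip n T U d =
     (let d' = flipped_diagonal n T d
      in (flip n T d, if d' \<in> U then flip n U d' else U))"

definition obtained_by_flip :: "nat \<Rightarrow> triangulation_pair \<Rightarrow> triangulation_pair \<Rightarrow> bool" where
  "obtained_by_flip n P Q \<longleftrightarrow>
     (\<exists>d \<in> fst P. Q = joint_flip n (fst P) (snd P) d) \<or>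
     (\<exists>d \<in> snd P. Q = prod.swap (joint_flip n (snd P) (fst P) d))"

definition adjacent :: "nat \<Rightarrow> triangulation_pair \<Rightarrow> triangulation_pair \<Rightarrow> bool" where
  "adjacent n P Q \<longleftrightarrow> P \<in> disjoint_pairs n \<and> Q \<in> disjoint_pairs n \<and>
     (obtained_by_flip n P Q \<or> obtained_by_flip n Q P)"

definition neighbours :: "nat \<Rightarrow> triangulation_pair \<Rightarrow> triangulation_pair set" where
  "neighbours n P = {Q. adjacent n P Q}"


section \<open>Markov chains and total variation distance\<close>

text \<open>\<open>K x\<close> is the law of the next state given the current state \<open>x\<close>. The whole history
  \<open>X 0, \<dots>, X t\<close> is conditioned on, so the Markov property is included. The
  definition is meant for countable \<open>S\<close>.\<close>

definition markov_chain ::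
    "'w measure \<Rightarrow> 's set \<Rightarrow> ('s \<Rightarrow> 's pmf) \<Rightarrow> (nat \<Rightarrow> 'w \<Rightarrow> 's) \<Rightarrow> bool" where
  "markov_chain M S K X \<longleftrightarrow>
     prob_space M \<and>
     (\<forall>t. X t \<in> measurable M (count_space S)) \<and>
     (\<forall>t h y. \<P>(\<omega> in M. \<forall>i\<le>t. X i \<omega> = h i) > 0 \<longrightarrow>
        \<P>(\<omega> in M. X (Suc t) \<omega> = y \<bar> \<forall>i\<le>t. X i \<omega> = h i) = pmf (K (h t)) y)"

definition total_variation :: "'s measure \<Rightarrow> 's measure \<Rightarrow> real" where
  "total_variation M N = (SUP A \<in> sets M. \<bar>measure M A - measure N A\<bar>)"

end

(*
  A pair (T, U) has card T + card U neighbours: flips are reversible, hence every neighbour is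
  itself the result of a flip, and two different flips never agree, since a flip in T agreeing with
  a flip in U would exchange the two diagonals of one quadrilateral, which must then be the whole
  polygon (impossible for n >= 5). Flips preserve card T + card U, so once the graph is known to be
  connected it is regular and the uniform distribution is stationary; the number n - 3 of diagonals
  is never needed.

  Connectedness: a triangulation that is not the fan at v has a flip that increases the degree of v.
  Move T to the fan at 1, then U to the fan at 2; by disjointness U has no diagonal at 1, and none
  is created, so the second phase keeps T fixed. Aperiodicity: if the flip of d in U also flips e in
  T, then flipping first e in T and then d in U gives the same pair, which is a triangle through
  (T, U). The flip at {2, n} in the pair of fans is of this kind.

  Hence for some L there is a walk of length exactly L between any two vertices, and L steps of the
  averaging operator contract the oscillation of a distribution by the factor 1 - 1 / D ^ L.
*)
theory Submission
  imports Defs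
begin

section \<open>Random walks on finite regular graphs\<close>

text \<open>A single walk of length \<open>k\<close> already carries the weight \<open>1 / D ^ k\<close> in the \<open>k\<close>-fold average.\<close>

lemma neighbour_average_le:
  fixes F :: "nat \<Rightarrow> 's \<Rightarrow> real"
  assumes N: "\<And>x. x \<in> S \<Longrightarrow> N x \<subseteq> S" "\<And>x. x \<in> S \<Longrightarrow> card (N x) = D" "D > 0"
    and step: "\<And>t x. x \<in> S \<Longrightarrow> F (Suc t) x = (\<Sum>y\<in>N x. F t y) / D"
    and bound: "\<And>y. y \<in> S \<Longrightarrow> F t y \<le> b"
    and walk: "(x, y) \<in> {(x, y). x \<in> S \<and> y \<in> N x} ^^ k" and "x \<in> S"
  shows "F (t + k) x \<le> b - (b - F t y) / D ^ k"
proof -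
  let ?R = "{(x, y). x \<in> S \<and> y \<in> N x}"
  have le: "F (t + k) x \<le> b" if "x \<in> S" for k x
    using that
  proof (induction k arbitrary: x)
    case 0
    then show ?case by (simp add: bound)
  next
    case (Suc k)
    have "(\<Sum>y\<in>N x. F (t + k) y) \<le> (\<Sum>y\<in>N x. b)"
      using Suc N(1) by (intro sum_mono) auto
    also have "\<dots> = D * b" using N(2)[OF Suc.prems] by simp
    finally show ?case
      using N(3) step[OF Suc.prems, of "t + k"] by (simp add: pos_divide_le_eq mult.commute)
  qed
  show ?thesis
    using walk \<open>x \<in> S\<close>
  proof (induction k arbitrary: x)
    case 0
    then show ?case by simp
  next
    case (Suc k)
    then obtain z where z: "z \<in> N x" "(z, y) \<in> ?R ^^ k"
      using relpow_Suc_D2[of x y k ?R] by blast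
    have fin: "finite (N x)" using N(2)[OF Suc.prems(2)] N(3) by (metis card.infinite less_numeral_extra(3))
    \<comment> \<open>The next vertex \<open>z\<close> of the walk keeps a deficit below
      \<open>b\<close>, while the other \<open>D - 1\<close> neighbours are only bounded by
      \<open>b\<close>; averaging divides the deficit by \<open>D\<close>.\<close>
    have "(\<Sum>w\<in>N x. F (t + k) w) = F (t + k) z + (\<Sum>w\<in>N x - {z}. F (t + k) w)"
      using fin z by (simp add: sum.remove)
    also have "\<dots> \<le> (b - (b - F t y) / D ^ k) + (\<Sum>w\<in>N x - {z}. b)"
    proof (intro add_mono sum_mono)
      show "F (t + k) z \<le> b - (b - F t y) / D ^ k"
        using Suc.IH[OF z(2)] N(1)[OF Suc.prems(2)] z(1) by blast
      show "F (t + k) w \<le> b" if "w \<in> N x - {z}" for w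
        using le N(1)[OF Suc.prems(2)] that by blast
    qed
    also have "\<dots> = D * b - (b - F t y) / D ^ k"
      using fin z N(2)[OF Suc.prems(2)] N(3) by (simp add: of_nat_diff algebra_simps)
    finally have "(\<Sum>w\<in>N x. F (t + k) w) / D \<le> (D * b - (b - F t y) / D ^ k) / D"
      by (simp add: divide_right_mono)
    also have "\<dots> = b - (b - F t y) / D ^ Suc k"
      using N(3) by (simp add: field_simps)
    finally show ?case using step[OF Suc.prems(2), of "t + k"] by simp
  qed
qed

text \<open>Averaging never raises the maximum over \<open>S\<close> nor lowers the minimum, and the
  fixed total mass keeps \<open>1 / card S\<close> between them; it remains to shrink the
  gap.\<close>

lemma neighbour_average_tendsto:
  fixes F :: "nat \<Rightarrow> 's \<Rightarrow> real"
  assumes S: "finite S"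
    and N: "\<And>x. x \<in> S \<Longrightarrow> N x \<subseteq> S" "\<And>x. x \<in> S \<Longrightarrow> card (N x) = D" "D > 0"
    and step: "\<And>t x. x \<in> S \<Longrightarrow> F (Suc t) x = (\<Sum>y\<in>N x. F t y) / D"
    and mass: "\<And>t. (\<Sum>x\<in>S. F t x) = 1"
    and walk: "\<And>x y. x \<in> S \<Longrightarrow> y \<in> S \<Longrightarrow> (x, y) \<in> {(x, y). x \<in> S \<and> y \<in> N x} ^^ L"
    and "x \<in> S"
  shows "(\<lambda>t. F t x) \<longlonglongrightarrow> 1 / card S"
proof -
  have ne: "S \<noteq> {}" using \<open>x \<in> S\<close> by auto
  define M where "M t = Max (F t ` S)" for t
  define m where "m t = Min (F t ` S)" for t
  have M: "F t x \<le> M t" and m: "m t \<le> F t x" if "x \<in> S" for t x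
    using that S by (auto simp: M_def m_def)
  have attained: "\<exists>y\<in>S. F t y = M t" "\<exists>y\<in>S. F t y = m t" for t
    using Max_in[of "F t ` S"] Min_in[of "F t ` S"] S ne by (auto simp: M_def m_def image_iff)
  have up: "F (Suc t) x \<le> M t" and lo: "m t \<le> F (Suc t) x" if x: "x \<in> S" for t x
  proof -
    have "(\<Sum>y\<in>N x. F t y) \<le> (\<Sum>y\<in>N x. M t)" "(\<Sum>y\<in>N x. m t) \<le> (\<Sum>y\<in>N x. F t y)"
      by (intro sum_mono M m; use N(1)[OF x] in blast)+
    then show "F (Suc t) x \<le> M t" "m t \<le> F (Suc t) x"
      using N(2)[OF x] N(3) step[OF x, of t]
      by (simp_all add: pos_divide_le_eq pos_le_divide_eq mult.commute)
  qed
  have Mdec: "M (t + k) \<le> M t" and minc: "m t \<le> m (t + k)" for t k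
  proof -
    have "M (Suc t) \<le> M t" "m t \<le> m (Suc t)" for t
      using attained[of "Suc t"] up lo by metis+
    then have "antimono M" "mono m"
      by (auto intro: decseq_SucI incseq_SucI)
    then show "M (t + k) \<le> M t" "m t \<le> m (t + k)"
      using antimonoD[of M t "t + k"] monoD[of m t "t + k"] by simp_all
  qed
  define q where "q = 1 - 1 / real D ^ L"
  have q: "0 \<le> q" "q < 1"
    using N(3) by (auto simp: q_def field_simps)
  have contract: "M (t + L) - m (t + L) \<le> q * (M t - m t)" for t
  proof -
    \<comment> \<open>A walk of length \<open>L\<close> from a maximiser at time
      \<open>t + L\<close> to a minimiser at time \<open>t\<close> pushes the new maximum below the
      old one by a share \<open>1 / D ^ L\<close> of the gap.\<close>
    obtain y where y: "y \<in> S" "F t y = m t" using attained by blast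
    obtain z where z: "z \<in> S" "F (t + L) z = M (t + L)" using attained by blast
    have "M (t + L) \<le> M t - (M t - m t) / D ^ L"
      using neighbour_average_le[where F = F and S = S and b = "M t", OF N step M walk[OF z(1) y(1)] z(1)]
        y z by simp
    then show ?thesis using minc[of t L] by (simp add: q_def algebra_simps)
  qed
  have geom: "M (k * L) - m (k * L) \<le> q ^ k * (M 0 - m 0)" for k
  proof (induction k)
    case (Suc k)
    have "M (k * L + L) - m (k * L + L) \<le> q * (q ^ k * (M 0 - m 0))"
      using contract[of "k * L"] mult_left_mono[OF Suc q(1)] by linarith
    then show ?case by (simp add: algebra_simps)
  qed simp
  have osc0: "0 \<le> M t - m t" for t using M[OF \<open>x \<in> S\<close>, of t] m[OF \<open>x \<in> S\<close>, of t] by linarith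
  have osc: "(\<lambda>t. M t - m t) \<longlonglongrightarrow> 0"
  proof (rule LIMSEQ_I)
    fix r :: real assume "r > 0"
    have "(\<lambda>k. q ^ k * (M 0 - m 0)) \<longlonglongrightarrow> 0 * (M 0 - m 0)"
      using q by (intro tendsto_mult_right LIMSEQ_realpow_zero)
    then have "eventually (\<lambda>k. q ^ k * (M 0 - m 0) < r) sequentially"
      using \<open>r > 0\<close> by (auto dest: order_tendstoD(2))
    then obtain k where k: "q ^ k * (M 0 - m 0) < r" by (auto simp: eventually_sequentially)
    \<comment> \<open>Geometric decay is known at multiples of \<open>L\<close> only; monotonicity
      of \<open>M\<close> and \<open>m\<close> carries it to all later times.\<close>
    have "norm (M t - m t - 0) < r" if "t \<ge> k * L" for t
      using Mdec[of "k * L" "t - k * L"] minc[of "k * L" "t - k * L"] osc0[of t] k geom[of k] that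
      by (auto simp: abs_if)
    then show "\<exists>no. \<forall>t\<ge>no. norm (M t - m t - 0) < r" by blast
  qed
  have "\<bar>F t x - 1 / card S\<bar> \<le> M t - m t" for t
  proof -
    have c: "real (card S) > 0" using S ne by (simp add: card_gt_0_iff)
    have "(\<Sum>x\<in>S. F t x) \<le> (\<Sum>x\<in>S. M t)" "(\<Sum>x\<in>S. m t) \<le> (\<Sum>x\<in>S. F t x)"
      by (intro sum_mono M m; assumption)+
    then have "1 / card S \<le> M t" "m t \<le> 1 / card S"
      using mass c by (simp_all add: field_simps)
    then show ?thesis using M[OF \<open>x \<in> S\<close>, of t] m[OF \<open>x \<in> S\<close>, of t] by linarith
  qed
  then have "(\<lambda>t. F t x - 1 / card S) \<longlonglongrightarrow> 0"
    using osc by (intro tendsto_rabs_zero_cancel[OF tendsto_sandwich[OF _ _ tendsto_const osc]]) auto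
  then show ?thesis by (simp add: LIM_zero_iff)
qed

section \<open>Laws of a Markov chain and their total variation distance\<close>

text \<open>The chain is given by conditioning on whole histories. Summing over the finitely many
  histories up to time \<open>t\<close> and grouping them by their last state yields the recursion
  for the one-time laws.\<close>

lemma markov_chain_step:
  assumes mc: "markov_chain M S K X" and S: "finite S"
  shows "measure M (X (Suc t) -` {y} \<inter> space M)
    = (\<Sum>x\<in>S. measure M (X t -` {x} \<inter> space M) * pmf (K x) y)"
proof -
  interpret prob_space M using mc by (simp add: markov_chain_def)
  have meas: "X t \<in> measurable M (count_space S)" for t
    using mc by (simp add: markov_chain_def)
  have XS: "X t \<omega> \<in> S" if "\<omega> \<in> space M" for t \<omega>
    using measurable_space[OF meas that] by simp
  have single: "{\<omega> \<in> space M. X t \<omega> = x} \<in> sets M" for t x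
  proof -
    have "{\<omega> \<in> space M. X t \<omega> = x} = X t -` ({x} \<inter> S) \<inter> space M" using XS by auto
    then show ?thesis using measurable_sets[OF meas, of "{x} \<inter> S" t] by simp
  qed
  define H where "H h = {\<omega> \<in> space M. \<forall>i\<le>t. X i \<omega> = h i}" for h
  have Hs: "H h \<in> sets M" for h
  proof -
    have "H h = (\<Inter>i\<in>{..t}. {\<omega> \<in> space M. X i \<omega> = h i})" by (auto simp: H_def)
    then show ?thesis using single by (auto intro!: sets.finite_INT)
  qed
  define Y where "Y = {\<omega> \<in> space M. X (Suc t) \<omega> = y}"
  have Ys: "Y \<in> sets M" using single by (simp add: Y_def)
  have HY: "prob (H h \<inter> Y) = prob (H h) * pmf (K (h t)) y" for h
  proof (cases "prob (H h) > 0")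
    case True
    have "\<P>(\<omega> in M. X (Suc t) \<omega> = y \<bar> \<forall>i\<le>t. X i \<omega> = h i) = pmf (K (h t)) y"
      using mc True by (auto simp: markov_chain_def H_def)
    moreover have "H h \<inter> Y = {\<omega> \<in> space M. X (Suc t) \<omega> = y \<and> (\<forall>i\<le>t. X i \<omega> = h i)}"
      by (auto simp: H_def Y_def)
    ultimately show ?thesis using True by (simp add: cond_prob_def H_def field_simps)
  next
    \<comment> \<open>\<open>markov_chain\<close> says nothing about histories of probability zero,
      but then both sides vanish.\<close>
    case False
    then have "prob (H h) = 0" by (simp add: zero_less_measure_iff)
    moreover have "prob (H h \<inter> Y) \<le> prob (H h)" using Hs by (intro finite_measure_mono) auto
    ultimately show ?thesis by (simp add: measure_le_0_iff)
  qed
  \<comment> \<open>Histories are taken extensional on \<open>{..t}\<close>: this makes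
    \<open>I\<close> finite, and two different members differ at some time up to \<open>t\<close>,
    so their events are disjoint.\<close>
  define I where "I = PiE {..t} (\<lambda>_. S)"
  have finI: "finite I" using S by (simp add: I_def finite_PiE)
  have hist: "restrict (\<lambda>i. X i \<omega>) {..t} \<in> I" if "\<omega> \<in> space M" for \<omega>
    using XS[OF that] by (auto simp: I_def)
  have split: "prob B = (\<Sum>h\<in>I. prob (H h \<inter> B))" if "B \<in> sets M" for B
  proof -
    have "(\<Union>h\<in>I. H h \<inter> B) = B"
    proof (intro equalityI subsetI)
      fix \<omega> assume w: "\<omega> \<in> B"
      then have "\<omega> \<in> space M" using that sets.sets_into_space by blast
      then have "restrict (\<lambda>i. X i \<omega>) {..t} \<in> I" "\<omega> \<in> H (restrict (\<lambda>i. X i \<omega>) {..t})"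
        using hist by (auto simp: H_def)
      then show "\<omega> \<in> (\<Union>h\<in>I. H h \<inter> B)" using w by blast
    qed auto
    moreover have "disjoint_family_on (\<lambda>h. H h \<inter> B) I"
      unfolding disjoint_family_on_def
    proof (intro ballI impI)
      fix g h assume gh: "g \<in> I" "h \<in> I" "g \<noteq> h"
      then obtain i where "i \<in> {..t}" "g i \<noteq> h i" unfolding I_def by (metis PiE_ext)
      then show "H g \<inter> B \<inter> (H h \<inter> B) = {}" by (auto simp: H_def)
    qed
    ultimately show ?thesis
      using finite_measure_finite_Union[OF finI, of "\<lambda>h. H h \<inter> B"] that Hs by auto
  qed
  have Xt: "prob {\<omega> \<in> space M. X t \<omega> = x} = (\<Sum>h | h \<in> I \<and> h t = x. prob (H h))" for x
  proof -
    have "prob (H h \<inter> {\<omega> \<in> space M. X t \<omega> = x}) = (if h t = x then prob (H h) else 0)" for h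
    proof -
      have "H h \<inter> {\<omega> \<in> space M. X t \<omega> = x} = (if h t = x then H h else {})" by (auto simp: H_def)
      then show ?thesis by simp
    qed
    then show ?thesis using split[OF single, of t x] finI by (simp add: sum.If_cases Int_def)
  qed
  have "prob Y = (\<Sum>h\<in>I. prob (H h) * pmf (K (h t)) y)"
    using split[OF Ys] HY by simp
  also have "\<dots> = (\<Sum>x\<in>S. \<Sum>h | h \<in> I \<and> h t = x. prob (H h) * pmf (K (h t)) y)"
    using S finI by (intro sum.group[symmetric]) (auto simp: I_def)
  also have "\<dots> = (\<Sum>x\<in>S. prob {\<omega> \<in> space M. X t \<omega> = x} * pmf (K x) y)"
    by (intro sum.cong refl) (simp add: Xt sum_distrib_right)
  finally show ?thesis by (simp add: Y_def vimage_def Int_def conj_commute)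
qed

text \<open>Both laws are sums of point masses, so the discrepancy on any set is at most the sum of
  the pointwise ones. The outer absolute value suits the comparison with a null sequence.\<close>

lemma total_variation_uniform_le:
  assumes "prob_space M" and meas: "Y \<in> measurable M (count_space S)" and S: "finite S"
  shows "\<bar>total_variation (distr M (count_space S) Y) (uniform_count_measure S)\<bar>
    \<le> (\<Sum>x\<in>S. \<bar>measure M (Y -` {x} \<inter> space M) - 1 / card S\<bar>)" (is "\<bar>?tv\<bar> \<le> ?s")
proof -
  interpret prob_space M by fact
  have diff: "\<bar>measure (distr M (count_space S) Y) A - measure (uniform_count_measure S) A\<bar> \<le> ?s"
    if "A \<subseteq> S" for A
  proof -
    have fin: "finite A" using that S finite_subset by blast
    have "measure (distr M (count_space S) Y) A = prob (Y -` A \<inter> space M)"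
      using that by (intro measure_distr[OF meas]) simp
    also have "Y -` A \<inter> space M = (\<Union>x\<in>A. Y -` {x} \<inter> space M)" by auto
    also have "prob \<dots> = (\<Sum>x\<in>A. prob (Y -` {x} \<inter> space M))"
      using that by (intro finite_measure_finite_Union fin)
        (auto simp: disjoint_family_on_def intro!: measurable_sets[OF meas])
    finally have "measure (distr M (count_space S) Y) A - measure (uniform_count_measure S) A
      = (\<Sum>x\<in>A. prob (Y -` {x} \<inter> space M) - 1 / card S)"
      using that S by (simp add: measure_uniform_count_measure sum_subtractf)
    also have "\<bar>\<dots>\<bar> \<le> (\<Sum>x\<in>A. \<bar>prob (Y -` {x} \<inter> space M) - 1 / card S\<bar>)" by simp
    also have "\<dots> \<le> ?s" using that S by (intro sum_mono2) auto
    finally show ?thesis .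
  qed
  have "?tv \<le> ?s"
    unfolding total_variation_def by (rule cSUP_least) (auto intro: diff)
  \<comment> \<open>The empty set contributes 0, and the bound on all discrepancies makes the
    supremum a genuine upper bound.\<close>
  moreover have "0 \<le> ?tv"
    unfolding total_variation_def
    by (rule cSUP_upper2[where x = "{}"]) (auto intro!: bdd_aboveI2[where M = ?s] diff)
  ultimately show ?thesis by simp
qed

text \<open>By symmetry the states that can move to \<open>y\<close> are the neighbours of
  \<open>y\<close>, and by regularity each does so with probability \<open>1 / D\<close>. Thus the
  law itself evolves by neighbour averages.\<close>

theorem random_walk_regular_graph_converges:
  fixes X :: "nat \<Rightarrow> 'w \<Rightarrow> 's"
  assumes S: "finite S"
    and N: "\<And>x. x \<in> S \<Longrightarrow> N x \<subseteq> S" "\<And>x. x \<in> S \<Longrightarrow> card (N x) = D" "D > 0"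
    and sym: "\<And>x y. x \<in> S \<Longrightarrow> y \<in> N x \<Longrightarrow> x \<in> N y"
    and walk: "\<And>x y. x \<in> S \<Longrightarrow> y \<in> S \<Longrightarrow> (x, y) \<in> {(x, y). x \<in> S \<and> y \<in> N x} ^^ L"
    and mc: "markov_chain M S (\<lambda>x. pmf_of_set (N x)) X"
  shows "(\<lambda>t. total_variation (distr M (count_space S) (X t)) (uniform_count_measure S))
    \<longlonglongrightarrow> 0"
proof -
  interpret prob_space M using mc by (simp add: markov_chain_def)
  have meas: "X t \<in> measurable M (count_space S)" for t
    using mc by (simp add: markov_chain_def)
  define F where "F t x = prob (X t -` {x} \<inter> space M)" for t x
  have step: "F (Suc t) y = (\<Sum>x\<in>N y. F t x) / D" if y: "y \<in> S" for t y
  proof -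
    have K: "pmf (pmf_of_set (N x)) y = (if x \<in> N y then 1 / D else 0)" if x: "x \<in> S" for x
    proof -
      have "finite (N x)" "N x \<noteq> {}" using N(2)[OF x] N(3) by (auto intro: card_ge_0_finite)
      then show ?thesis using sym[OF x] sym[OF y] N(2)[OF x] by (auto simp: indicator_def)
    qed
    have "F (Suc t) y = (\<Sum>x\<in>S. F t x * pmf (pmf_of_set (N x)) y)"
      unfolding F_def by (rule markov_chain_step[OF mc S])
    also have "\<dots> = (\<Sum>x\<in>S. if x \<in> N y then F t x / D else 0)"
      by (intro sum.cong refl) (simp add: K)
    also have "\<dots> = (\<Sum>x\<in>S \<inter> N y. F t x / D)"
      using S by (simp add: sum.inter_restrict)
    also have "S \<inter> N y = N y" using N(1)[OF y] by auto
    finally show ?thesis by (simp add: sum_divide_distrib)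
  qed
  have mass: "(\<Sum>x\<in>S. F t x) = 1" for t
  proof -
    have "(\<Sum>x\<in>S. F t x) = prob (\<Union>x\<in>S. X t -` {x} \<inter> space M)"
      unfolding F_def using S
      by (intro finite_measure_finite_Union[symmetric])
        (auto simp: disjoint_family_on_def intro!: measurable_sets[OF meas])
    also have "(\<Union>x\<in>S. X t -` {x} \<inter> space M) = space M"
      using measurable_space[OF meas] by fastforce
    finally show ?thesis by (simp add: prob_space)
  qed
  have "(\<lambda>t. F t x) \<longlonglongrightarrow> 1 / card S" if "x \<in> S" for x
    by (rule neighbour_average_tendsto[where N = N and D = D and L = L])
      (use S N step mass walk that in auto)
  then have "(\<lambda>t. \<Sum>x\<in>S. \<bar>F t x - 1 / card S\<bar>) \<longlonglongrightarrow> (\<Sum>x\<in>S. \<bar>1 / card S - 1 / card S\<bar>)"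
    by (intro tendsto_sum tendsto_rabs tendsto_diff tendsto_const)
  then have lim: "(\<lambda>t. \<Sum>x\<in>S. \<bar>F t x - 1 / card S\<bar>) \<longlonglongrightarrow> 0" by simp
  show ?thesis
    by (rule Lim_null_comparison[OF _ lim])
      (use total_variation_uniform_le[OF prob_space_axioms meas S] in \<open>auto simp: F_def\<close>)
qed

section \<open>Walks of one common length\<close>

text \<open>Closed walks of lengths 2 and 3 at the hub \<open>c\<close> combine to every length from
  2 on, so walks through \<open>c\<close> can be padded to the same length.\<close>

lemma exact_length_walks:
  assumes S: "finite S" and sym: "sym R"
    and hub: "\<And>x. x \<in> S \<Longrightarrow> (x, c) \<in> R\<^sup>*"
    and c2: "(c, c) \<in> R ^^ 2" and c3: "(c, c) \<in> R ^^ 3"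
  shows "\<exists>L. \<forall>x\<in>S. \<forall>y\<in>S. (x, y) \<in> R ^^ L"
proof -
  have "\<forall>x\<in>S. \<exists>k. (x, c) \<in> R ^^ k" using hub rtrancl_power by metis
  then obtain l where l: "\<And>x. x \<in> S \<Longrightarrow> (x, c) \<in> R ^^ l x" by metis
  define B where "B = Max (l ` S)"
  have B: "l x \<le> B" if "x \<in> S" for x using S that by (simp add: B_def)
  have reverse: "(c, x) \<in> R ^^ k" if "(x, c) \<in> R ^^ k" for x k
    using that
  proof (induction k arbitrary: x)
    case (Suc k)
    then obtain z where "(x, z) \<in> R" "(z, c) \<in> R ^^ k" by (blast dest: relpow_Suc_D2)
    then show ?case using Suc.IH sym by (auto dest: symD)
  qed simp
  have loop: "(c, c) \<in> R ^^ (k + 2)" for k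
  proof (induction k rule: less_induct)
    case (less k)
    show ?case
    proof (cases "k \<ge> 2")
      case True
      then have "(c, c) \<in> R ^^ (k - 2 + 2) O R ^^ 2" using less[of "k - 2"] c2 by auto
      then have "(c, c) \<in> R ^^ (k - 2 + 2 + 2)" unfolding relpow_add by simp
      also have "k - 2 + 2 + 2 = k + 2" using True by simp
      finally show ?thesis .
    next
      case False
      then have "k + 2 = 2 \<or> k + 2 = 3" by auto
      then show ?thesis using c2 c3 by metis
    qed
  qed
  have "(x, y) \<in> R ^^ (2 * B + 2)" if "x \<in> S" "y \<in> S" for x y
  proof -
    \<comment> \<open>\<open>B\<close> bounds both \<open>l x\<close> and \<open>l y\<close>, so the
      loop at \<open>c\<close> is left with a length of at least 2.\<close>
    have "2 * B + 2 = l x + (2 * B - l x - l y + 2) + l y"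
      using B[OF that(1)] B[OF that(2)] by simp
    moreover have "(x, y) \<in> R ^^ (l x + (2 * B - l x - l y + 2) + l y)"
      by (subst relpow_add, rule relcompI, subst relpow_add, rule relcompI)
        (rule l[OF that(1)] loop reverse[OF l[OF that(2)]])+
    ultimately show ?thesis by simp
  qed
  then show ?thesis by blast
qed


section \<open>Flips in triangulations\<close>

text \<open>Strict cyclic order: going upwards from \<open>a\<close>, with wrap-around,
  \<open>x\<close> comes before \<open>b\<close>. Invariance under rotation removes case
  distinctions on where the labels wrap.\<close>

definition cyc :: "nat \<Rightarrow> nat \<Rightarrow> nat \<Rightarrow> bool" where
  "cyc a x b \<longleftrightarrow> a < x \<and> x < b \<or> x < b \<and> b < a \<or> b < a \<and> a < x"

lemma cyc_rotate: "cyc a b c \<Longrightarrow> cyc b c a"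
  unfolding cyc_def by linarith

lemma cyc_trans: "cyc a x y \<Longrightarrow> cyc a y z \<Longrightarrow> cyc x y z"
  unfolding cyc_def by linarith

lemma cyc_opposite: "cyc a x b \<Longrightarrow> cyc b y a \<Longrightarrow> cyc a x y"
  unfolding cyc_def by linarith

lemma cyc_between: "cyc a p b \<Longrightarrow> cyc a x b \<Longrightarrow> p \<noteq> x \<Longrightarrow> cyc a p x \<or> cyc x p b"
  unfolding cyc_def by linarith

lemma crosses_iff: "crosses {a, b} {x, y} \<longleftrightarrow> cyc a x b \<and> cyc b y a \<or> cyc a y b \<and> cyc b x a"
proof
  assume "crosses {a, b} {x, y}"
  then obtain a' b' x' y' where *: "{a, b} = {a', b'}" "{x, y} = {x', y'}"
    "a' < x' \<and> x' < b' \<and> b' < y' \<or> x' < a' \<and> a' < y' \<and> y' < b'"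
    unfolding crosses_def by blast
  then show "cyc a x b \<and> cyc b y a \<or> cyc a y b \<and> cyc b x a"
    unfolding doubleton_eq_iff by (elim disjE conjE) (simp_all add: cyc_def)
next
  assume *: "cyc a x b \<and> cyc b y a \<or> cyc a y b \<and> cyc b x a"
  have I: "crosses {a, b} {x, y}" if "a < b" "cyc a x b" "cyc b y a" for a b x y
  proof -
    have "a < x" "x < b" "b < y \<or> y < a" using that by (auto simp: cyc_def)
    then have "a < x \<and> x < b \<and> b < y \<or> y < a \<and> a < x \<and> x < b" by simp
    then show ?thesis
    proof
      assume "a < x \<and> x < b \<and> b < y"
      then show ?thesis unfolding crosses_def by metis
    next
      assume "y < a \<and> a < x \<and> x < b"
      moreover have "{x, y} = {y, x}" by auto
      ultimately show ?thesis unfolding crosses_def by metis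
    qed
  qed
  have "a < b \<or> b < a" using * by (auto simp: cyc_def)
  then show "crosses {a, b} {x, y}"
    using * I[of a b x y] I[of a b y x] I[of b a x y] I[of b a y x]
    unfolding insert_commute[of b a "{}"] insert_commute[of y x "{}"] by argo
qed

lemma crosses_commute: "crosses d e \<longleftrightarrow> crosses e d"
proof -
  have "crosses e d" if "crosses d e" for d e
  proof -
    obtain a b x y where *: "d = {a, b}" "e = {x, y}"
      "a < x \<and> x < b \<and> b < y \<or> x < a \<and> a < y \<and> y < b"
      using \<open>crosses d e\<close> unfolding crosses_def by (elim exE conjE) (rule that)
    show ?thesis
      unfolding crosses_def
      by (rule exI[of _ x], rule exI[of _ y], rule exI[of _ a], rule exI[of _ b]) (use * in \<open>simp add: disj_commute\<close>)
  qed
  then show ?thesis by blast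
qed

text \<open>A segment that enters the triangle \<open>a, x, b\<close> across \<open>{a, b}\<close>
  and does not end at the apex \<open>x\<close> has to leave it across one of the other two
  sides.\<close>

lemma cyc_cross_side:
  assumes x: "cyc a x b" and pq: "cyc a p b" "cyc b q a" and "p \<noteq> x"
  shows "crosses {p, q} {a, x} \<or> crosses {p, q} {x, b}"
proof -
  have apq: "cyc a p q" and axq: "cyc a x q" using cyc_opposite x pq by blast+
  consider "cyc a p x" | "cyc x p b" using cyc_between x pq(1) \<open>p \<noteq> x\<close> by blast
  then show ?thesis
  proof cases
    case 1
    then have "cyc p x q" using axq cyc_trans by blast
    moreover have "cyc q a p" using apq cyc_rotate by blast
    ultimately show ?thesis by (simp add: crosses_iff)
  next
    case 2
    have "cyc b q p" using cyc_opposite pq by blast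
    then have "cyc p b q" using cyc_rotate by blast
    have "cyc b q x" using cyc_opposite x pq by blast
    then have "cyc x p q" using cyc_opposite 2 by blast
    then have "cyc q x p" using cyc_rotate by blast
    then show ?thesis using \<open>cyc p b q\<close> by (simp add: crosses_iff)
  qed
qed

lemma not_crosses_self: "\<not> crosses d d"
proof
  assume c: "crosses d d"
  then obtain a b where "d = {a, b}" unfolding crosses_def by (elim exE conjE) (rule that)
  then have "cyc a a b \<and> cyc b b a \<or> cyc a b b \<and> cyc b a a" using c crosses_iff by blast
  then show False by (auto simp: cyc_def)
qed

lemma noncrossing_iff: "noncrossing S \<longleftrightarrow> (\<forall>d\<in>S. \<forall>e\<in>S. \<not> crosses d e)"
  unfolding noncrossing_def pairwise_def using not_crosses_self by metis

section \<open>Sides and diagonals in cyclic terms\<close>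

lemma side_iff:
  "{a, b} \<in> sides n \<longleftrightarrow> a = n \<and> b = 1 \<or> a = 1 \<and> b = n \<or>
    1 \<le> a \<and> a < n \<and> b = a + 1 \<or> 1 \<le> b \<and> b < n \<and> a = b + 1"
  unfolding sides_def by (auto simp: doubleton_eq_iff)

text \<open>The vertex \<open>c\<close> lies on the arc from \<open>b\<close> on to
  \<open>a\<close>, so the empty arc of the side is the one from \<open>a\<close> to
  \<open>b\<close>; this orients an unordered pair.\<close>

lemma side_successor:
  assumes "{a, b} \<in> sides n" "cyc a b c" "c \<in> {1..n}"
  shows "a = n \<and> b = 1 \<or> b = a + 1"
  using assms unfolding side_iff cyc_def by auto

lemma diagonal_iff:
  "{a, b} \<in> diagonals n \<longleftrightarrow> a \<in> {1..n} \<and> b \<in> {1..n} \<and> a \<noteq> b \<and> {a, b} \<notin> sides n"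
  unfolding diagonals_def by (auto simp: doubleton_eq_iff)

lemma diagonalE:
  assumes "d \<in> diagonals n"
  obtains a b where "d = {a, b}" "a \<in> {1..n}" "b \<in> {1..n}" "a \<noteq> b" "{a, b} \<notin> sides n"
  using assms unfolding diagonals_def by blast

lemma finite_diagonals: "finite (diagonals n)"
  by (rule finite_subset[of _ "Pow {1..n}"]) (auto simp: diagonals_def)

text \<open>One of the two arcs cut off by a side contains no vertex.\<close>

lemma cyc_not_side:
  assumes "cyc a x b" "cyc b y a" "a \<in> {1..n}" "b \<in> {1..n}" "x \<in> {1..n}" "y \<in> {1..n}"
  shows "{a, b} \<notin> sides n"
  using assms unfolding side_iff cyc_def by auto

lemma diagonal_cyc:
  assumes "{a, b} \<in> diagonals n"
  obtains x where "x \<in> {1..n}" "cyc a x b"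
proof -
  have *: "1 \<le> a" "a \<le> n" "1 \<le> b" "b \<le> n" "a \<noteq> b" "a < n \<Longrightarrow> b \<noteq> a + 1" "a = n \<Longrightarrow> b \<noteq> 1"
    using assms by (auto simp: diagonal_iff side_iff)
  show ?thesis
  proof (cases "a = n")
    case True
    then show ?thesis using that[of 1] * by (simp add: cyc_def)
  next
    case False
    then have "cyc a (a + 1) b" using * unfolding cyc_def by linarith
    then show ?thesis using that[of "a + 1"] * False by simp
  qed
qed

lemma crosses_diagonal:
  assumes "cyc a x b" "cyc b y a" "a \<in> {1..n}" "b \<in> {1..n}" "x \<in> {1..n}" "y \<in> {1..n}"
  shows "{a, b} \<in> diagonals n"
  using assms cyc_not_side[OF assms] by (auto simp: diagonal_iff cyc_def)

lemma finite_attains_max: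
  fixes f :: "'a \<Rightarrow> nat"
  assumes "finite A" "A \<noteq> {}"
  shows "\<exists>x\<in>A. \<forall>y\<in>A. f y \<le> f x"
proof -
  have "Max (f ` A) \<in> f ` A" using assms by (intro Max_in) auto
  then show ?thesis using Max_ge[OF finite_imageI[OF assms(1)], of _ f] by fastforce
qed

section \<open>Triangles of a triangulation\<close>

locale triangulated_polygon =
  fixes n :: nat and T :: "nat set set"
  assumes n: "n \<ge> 3" and T: "triangulation n T"
begin

text \<open>Sides of the polygon count as edges, so that every triangle of the triangulation has
  three edges.\<close>

definition edge :: "nat \<Rightarrow> nat \<Rightarrow> bool" where
  "edge a b \<longleftrightarrow> {a, b} \<in> T \<union> sides n"

lemma edge_commute: "edge a b \<longleftrightarrow> edge b a"
  by (simp add: edge_def insert_commute)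

lemma T_subset: "T \<subseteq> diagonals n" using T by (simp add: triangulation_def)

lemma T_finite: "finite T" using T_subset finite_diagonals finite_subset by blast

lemma T_not_crosses: "d \<in> T \<Longrightarrow> e \<in> T \<Longrightarrow> \<not> crosses d e"
  using T unfolding triangulation_def noncrossing_iff by blast

lemma T_maximal:
  assumes "d \<in> diagonals n" "d \<notin> T"
  shows "\<exists>e\<in>T. crosses d e"
proof (rule ccontr)
  assume "\<not> ?thesis"
  then have "\<not> crosses d e \<and> \<not> crosses e d" if "e \<in> T" for e
    using that crosses_commute[of d e] by simp
  then have "noncrossing (insert d T)"
    using T_not_crosses not_crosses_self[of d] by (simp add: noncrossing_iff)
  moreover have "insert d T \<subseteq> diagonals n" "T \<subseteq> insert d T" using assms(1) T_subset by auto
  ultimately have "insert d T = T" using T by (simp add: triangulation_def)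
  then show False using assms by auto
qed

lemma edge_vertex: "edge a b \<Longrightarrow> a \<in> {1..n} \<and> b \<in> {1..n} \<and> a \<noteq> b"
proof -
  assume "edge a b"
  then consider "{a, b} \<in> diagonals n" | "{a, b} \<in> sides n"
    using T_subset unfolding edge_def by blast
  then show ?thesis
  proof cases
    case 1
    then show ?thesis unfolding diagonal_iff by blast
  next
    case 2
    then show ?thesis using n unfolding side_iff by auto
  qed
qed

lemma edge_not_cross: "edge a b \<Longrightarrow> edge x y \<Longrightarrow> cyc a x b \<Longrightarrow> \<not> cyc b y a"
proof
  assume *: "edge a b" "edge x y" "cyc a x b" "cyc b y a"
  then have "{a, b} \<notin> sides n" using cyc_not_side edge_vertex by metis
  moreover have "{x, y} \<notin> sides n"
  proof -
    have "cyc x b y" "cyc y a x" using * by (auto simp: cyc_def)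
    then show ?thesis using * cyc_not_side edge_vertex by metis
  qed
  ultimately have "{a, b} \<in> T" "{x, y} \<in> T" using * by (auto simp: edge_def)
  moreover have "crosses {a, b} {x, y}" using * by (simp add: crosses_iff)
  ultimately show False using T_not_crosses by blast
qed

lemma not_edge_cross:
  assumes "a \<in> {1..n}" "b \<in> {1..n}" "a \<noteq> b" "\<not> edge a b"
  obtains p q where "{p, q} \<in> T" "cyc a p b" "cyc b q a"
proof -
  have "{a, b} \<in> diagonals n" "{a, b} \<notin> T" using assms by (auto simp: diagonal_iff edge_def)
  then obtain e where e: "e \<in> T" "crosses {a, b} e" using T_maximal by blast
  then obtain p q where pq: "e = {p, q}" using T_subset diagonalE by (metis subsetD)
  then consider "cyc a p b" "cyc b q a" | "cyc a q b" "cyc b p a" using e crosses_iff by blast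
  then show ?thesis using that[of p q] that[of q p] e pq by cases (simp_all add: insert_commute)
qed

text \<open>The apex is the last vertex before \<open>b\<close> that is joined to \<open>a\<close>.
  A diagonal separating it from \<open>b\<close> could only end at \<open>a\<close>, and its other
  end would come later.\<close>

lemma triangle_exists:
  assumes ab: "edge a b" and x0: "x0 \<in> {1..n}" "cyc a x0 b"
  obtains x where "cyc a x b" "edge a x" "edge x b"
proof -
  define X where "X = {x \<in> {1..n}. cyc a x b \<and> edge a x}"
  \<comment> \<open>\<open>r\<close> unrolls the labels, so that the cyclic order starting after
    \<open>a\<close> becomes the numerical order.\<close>
  define r where "r x = (if x > a then x else x + n)" for x
  have V: "a \<in> {1..n}" "b \<in> {1..n}" "a \<noteq> b" using ab edge_vertex by auto
  have "(if a = n then 1 else a + 1) \<in> X"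
    using V x0 n by (auto simp: X_def cyc_def edge_def side_iff)
  moreover have "finite X" by (simp add: X_def)
  ultimately obtain x where x: "x \<in> X" "\<And>y. y \<in> X \<Longrightarrow> r y \<le> r x"
    using finite_attains_max[of X r] by blast
  then have xx: "x \<in> {1..n}" "cyc a x b" "edge a x" by (auto simp: X_def)
  have "edge x b"
  proof (rule ccontr)
    assume "\<not> edge x b"
    moreover have "x \<noteq> b" using xx by (auto simp: cyc_def)
    ultimately obtain p q where pq: "{p, q} \<in> T" "cyc x p b" "cyc b q x"
      using not_edge_cross xx V by metis
    then have e: "edge p q" "edge q p" by (auto simp: edge_def insert_commute)
    have "cyc a p b" using xx pq unfolding cyc_def by linarith
    then have "\<not> cyc b q a" using edge_not_cross[OF ab e(1)] by simp
    moreover have "\<not> cyc a q x"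
      using edge_not_cross[OF xx(3) e(2)] xx pq unfolding cyc_def by linarith
    ultimately have "q = a" using pq xx unfolding cyc_def by linarith
    then have "p \<in> X" using e edge_vertex \<open>cyc a p b\<close> by (auto simp: X_def)
    then have "r p \<le> r x" using x by simp
    then show False
      using pq xx V edge_vertex[OF e(1)] unfolding r_def cyc_def by (auto split: if_splits)
  qed
  then show ?thesis using that xx by blast
qed

text \<open>Of two apexes on the same arc, the one nearer to \<open>a\<close> has an edge to
  \<open>b\<close> that crosses the edge from \<open>a\<close> to the other.\<close>

lemma triangle_unique:
  assumes "cyc a x b" "edge a x" "edge x b" "cyc a y b" "edge a y" "edge y b"
  shows "x = y"
proof (rule ccontr)
  assume "x \<noteq> y"
  then consider "cyc a x y" | "cyc y x b" using assms cyc_between by blast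
  then show False
  proof cases
    case 1
    then have "cyc x y b" using assms cyc_trans by blast
    then show False
      using assms edge_not_cross[of x b y a] edge_commute cyc_rotate by blast
  next
    case 2
    then show False
      using assms edge_not_cross[of y b x a] edge_commute cyc_rotate by blast
  qed
qed

section \<open>Quadrilaterals and flips\<close>

text \<open>The two triangles of \<open>T\<close> on either side of \<open>{a, b}\<close>. Unlike in
  \<open>quadrilateral\<close>, the orientation of the corners is fixed.\<close>

definition quad :: "nat \<Rightarrow> nat \<Rightarrow> nat \<Rightarrow> nat \<Rightarrow> bool" where
  "quad a a' b b' \<longleftrightarrow> {a, b} \<in> T \<and> cyc a a' b \<and> cyc b b' a \<and>
     edge a a' \<and> edge a' b \<and> edge b b' \<and> edge b' a"

lemma quadE:
  assumes "{a, b} \<in> T"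
  obtains a' b' where "quad a a' b b'"
proof -
  have ab: "edge a b" "edge b a" "{a, b} \<in> diagonals n" "{b, a} \<in> diagonals n"
    using assms T_subset by (auto simp: edge_def insert_commute)
  obtain x y where "x \<in> {1..n}" "cyc a x b" "y \<in> {1..n}" "cyc b y a"
    using diagonal_cyc ab by metis
  then obtain a' b' where "cyc a a' b" "edge a a'" "edge a' b" "cyc b b' a" "edge b b'" "edge b' a"
    using triangle_exists[OF ab(1)] triangle_exists[OF ab(2)] by metis
  then show ?thesis using assms that by (auto simp: quad_def)
qed

text \<open>\<open>cyc_cross_side\<close> applies to the triangles on both sides of
  \<open>{a, b}\<close>: if no outer side may be crossed, the segment ends at both apexes.\<close>

lemma quad_cross_only:
  assumes q: "quad a a' b b'" and c: "crosses {p, q} {a, b}"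
    and nc: "\<not> crosses {p, q} {a, a'}" "\<not> crosses {p, q} {a', b}"
      "\<not> crosses {p, q} {b, b'}" "\<not> crosses {p, q} {b', a}"
  shows "{p, q} = {a', b'}"
proof -
  have ab: "cyc a a' b" "cyc b b' a" using q by (auto simp: quad_def)
  have *: "p = a' \<and> q = b'"
    if pq: "cyc a p b" "cyc b q a" and nc: "\<not> crosses {p, q} {a, a'}" "\<not> crosses {p, q} {a', b}"
      "\<not> crosses {p, q} {b, b'}" "\<not> crosses {p, q} {b', a}" for p q
    using cyc_cross_side[OF ab(1) pq] cyc_cross_side[OF ab(2) pq(2,1)] nc
    unfolding insert_commute[of q p "{}"] by blast
  have "cyc a p b \<and> cyc b q a \<or> cyc a q b \<and> cyc b p a"
    using c unfolding crosses_commute[of _ "{a, b}"] crosses_iff .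
  then show ?thesis using *[of p q] *[of q p] nc by (auto simp: insert_commute)
qed

lemma quad_inner_sides:
  assumes "quad a a' b b'"
  shows "{a, a'} \<noteq> {a, b}" "{a', b} \<noteq> {a, b}" "{b, b'} \<noteq> {a, b}" "{b', a} \<noteq> {a, b}"
  using assms by (auto simp: quad_def doubleton_eq_iff cyc_def)

lemma edge_crosses_imp:
  assumes "edge a b" "e \<in> diagonals n" "crosses e {a, b}"
  shows "{a, b} \<in> T"
proof -
  obtain p q where pq: "e = {p, q}" "p \<in> {1..n}" "q \<in> {1..n}"
    using assms diagonalE by metis
  have "cyc a p b \<and> cyc b q a \<or> cyc a q b \<and> cyc b p a"
    using assms(3) unfolding pq(1) crosses_commute[of _ "{a, b}"] crosses_iff .
  then have "{a, b} \<notin> sides n" using cyc_not_side edge_vertex[OF assms(1)] pq by metis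
  then show ?thesis using assms by (auto simp: edge_def)
qed

text \<open>By maximality \<open>e\<close> crosses a member of \<open>T\<close>, which must be
  \<open>{a, b}\<close>, and it crosses no side of the quadrilateral. This gives both the maximality
  of a flipped triangulation and the uniqueness of the exchanged diagonal.\<close>

lemma quad_exchange_only:
  assumes q: "quad a a' b b'" and e: "e \<in> diagonals n" "e \<notin> T"
    and nc: "\<And>f. f \<in> T \<Longrightarrow> f \<noteq> {a, b} \<Longrightarrow> \<not> crosses e f"
  shows "e = {a', b'}"
proof -
  obtain p r where pr: "e = {p, r}" using diagonalE e by metis
  have "crosses e {a, b}" using T_maximal e nc by blast
  moreover have "\<not> crosses e {x, y}" if "edge x y" "{x, y} \<noteq> {a, b}" for x y
    using edge_crosses_imp[OF that(1) e(1)] nc[OF _ that(2)] by argo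
  ultimately show ?thesis
    using quad_cross_only[OF q, of p r] quad_inner_sides[OF q] q unfolding pr quad_def by simp
qed

text \<open>For the last claim the two diagonals exchange roles: a member of \<open>T\<close>
  crossing \<open>{a', b'}\<close> crosses no side of the quadrilateral, so it ends at the apexes
  \<open>b\<close> and \<open>a\<close>.\<close>

lemma quad_other:
  assumes q: "quad a a' b b'"
  shows "{a', b'} \<in> diagonals n" "crosses {a, b} {a', b'}" "{a', b'} \<notin> T"
    and "\<And>f. f \<in> T \<Longrightarrow> crosses f {a', b'} \<Longrightarrow> f = {a, b}"
proof -
  have qq: "{a, b} \<in> T" "cyc a a' b" "cyc b b' a" "edge a a'" "edge a' b" "edge b b'" "edge b' a"
    using q by (auto simp: quad_def)
  have ab: "edge a b" using qq by (auto simp: edge_def)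
  have b: "cyc a' b b'" and a: "cyc b' a a'"
    using cyc_opposite[OF qq(2,3)] cyc_opposite[OF qq(3,2)] cyc_rotate by blast+
  have "a \<in> {1..n}" "a' \<in> {1..n}" "b \<in> {1..n}" "b' \<in> {1..n}" using qq edge_vertex by blast+
  then show "{a', b'} \<in> diagonals n" using crosses_diagonal[OF b a] by blast
  show c: "crosses {a, b} {a', b'}" using qq by (auto simp: crosses_iff)
  then show "{a', b'} \<notin> T" using qq T_not_crosses by blast
  fix f assume f: "f \<in> T" "crosses f {a', b'}"
  obtain p r where pr: "f = {p, r}" "cyc a' p b'" "cyc b' r a'"
  proof -
    obtain p r where "f = {p, r}" using f T_subset diagonalE by (metis subsetD)
    then show ?thesis using that f crosses_commute crosses_iff by (metis insert_commute)
  qed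
  have e: "edge p r" using f pr by (auto simp: edge_def)
  have nc: "\<not> crosses {p, r} {x, y}" "\<not> crosses {r, p} {x, y}" if "edge x y" for x y
    using edge_not_cross[OF e that] edge_not_cross[OF e, of y x] that edge_commute
    unfolding insert_commute[of r p "{}"] crosses_iff by blast+
  have "p = b"
    using cyc_cross_side[OF b pr(2,3)] nc qq by blast
  moreover have "r = a"
    using cyc_cross_side[OF a pr(3,2)] nc qq by blast
  ultimately show "f = {a, b}" using pr by auto
qed

lemma quad_flip_triangulation:
  assumes q: "quad a a' b b'"
  shows "triangulation n (insert {a', b'} (T - {{a, b}}))" (is "triangulation n ?T'")
  unfolding triangulation_def
proof (intro conjI allI impI)
  note o = quad_other[OF q]
  show "?T' \<subseteq> diagonals n" using o T_subset by auto
  show "noncrossing ?T'"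
  proof -
    have "\<not> crosses {a', b'} e \<and> \<not> crosses e {a', b'}" if "e \<in> T - {{a, b}}" for e
      using that o(4)[of e] crosses_commute[of e] by blast
    then show ?thesis
      using T_not_crosses not_crosses_self[of "{a', b'}"] by (simp add: noncrossing_iff)
  qed
  fix S assume S: "S \<subseteq> diagonals n \<and> noncrossing S \<and> ?T' \<subseteq> S"
  show "S = ?T'"
  proof (rule equalityI)
    show "?T' \<subseteq> S" using S by simp
    show "S \<subseteq> ?T'"
    proof
      fix e assume e: "e \<in> S"
      have nc: "\<not> crosses e f" if "f \<in> S" for f
        using S e that by (simp add: noncrossing_iff)
      show "e \<in> ?T'"
      proof (cases "e \<in> T")
        \<comment> \<open>The only member of \<open>T\<close> absent from the new set is
          \<open>{a, b}\<close>, and it crosses \<open>{a', b'}\<close>.\<close>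
        case True
        then show ?thesis using nc[of "{a', b'}"] S o by auto
      next
        case False
        have "e = {a', b'}"
          using quad_exchange_only[OF q _ False] nc S e by blast
        then show ?thesis by simp
      qed
    qed
  qed
qed

text \<open>This evaluates the definite description: the triangles on both sides of
  \<open>{a, b}\<close> are unique, and naming the corners in another orientation only swaps the
  ends of the new diagonal.\<close>

lemma quad_flipped:
  assumes q: "quad a a' b b'"
  shows "flipped_diagonal n T {a, b} = {a', b'}"
  unfolding flipped_diagonal_def
proof (rule the_equality)
  have qq: "{a, b} \<in> T" "cyc a a' b" "cyc b b' a" "edge a a'" "edge a' b" "edge b b'" "edge b' a"
    using q by (auto simp: quad_def)
  have "quadrilateral n (T - {{a, b}}) a a' b b'"
    using qq(4-7) quad_inner_sides[OF q] quad_other(2,3)[OF q]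
    unfolding quadrilateral_def edge_def by simp
  then show "\<exists>aa a'a ba b'a. {a, b} = {aa, ba} \<and> {a', b'} = {a'a, b'a} \<and>
       quadrilateral n (T - {{a, b}}) aa a'a ba b'a" by blast
  fix d' assume "\<exists>aa a' ba b'. {a, b} = {aa, ba} \<and> d' = {a', b'} \<and>
       quadrilateral n (T - {{a, b}}) aa a' ba b'"
  then obtain c c' e e' where *: "{a, b} = {c, e}" "d' = {c', e'}"
    "quadrilateral n (T - {{a, b}}) c c' e e'" by blast
  then have E: "edge c c'" "edge c' e" "edge e e'" "edge e' c" "crosses {c, e} {c', e'}"
    unfolding quadrilateral_def edge_def by (simp_all, argo+)
  then have F: "edge c' c" "edge e c'" "edge e' e" "edge c e'"
    "edge a' a" "edge b a'" "edge b' b" "edge a b'" using qq edge_commute by blast+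
  have "cyc c c' e \<and> cyc e e' c \<or> cyc c e' e \<and> cyc e c' c"
    using E crosses_iff by blast
  moreover have "c = a \<and> e = b \<or> c = b \<and> e = a" using * by (auto simp: doubleton_eq_iff)
  ultimately have "c' = a' \<and> e' = b' \<or> c' = b' \<and> e' = a'"
    using E F qq triangle_unique by metis
  then show "d' = {a', b'}" using * by auto
qed

lemma flip_triangulation:
  assumes "d \<in> T"
  shows "triangulation n (flip n T d)" "flipped_diagonal n T d \<in> diagonals n"
    "crosses d (flipped_diagonal n T d)" "flipped_diagonal n T d \<notin> T"
    and "\<And>f. f \<in> T \<Longrightarrow> crosses f (flipped_diagonal n T d) \<Longrightarrow> f = d"
proof -
  obtain a b where d: "d = {a, b}" using assms T_subset diagonalE by (metis subsetD)
  then obtain a' b' where q: "quad a a' b b'" using assms quadE by metis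
  show "triangulation n (flip n T d)" "flipped_diagonal n T d \<in> diagonals n"
    "crosses d (flipped_diagonal n T d)" "flipped_diagonal n T d \<notin> T"
    "\<And>f. f \<in> T \<Longrightarrow> crosses f (flipped_diagonal n T d) \<Longrightarrow> f = d"
    using quad_other[OF q] quad_flip_triangulation[OF q] quad_flipped[OF q] d
    by (auto simp: flip_def)
qed

text \<open>This recognises a flip from its result alone, so reversing a flip needs no search for
  the quadrilateral in the new triangulation.\<close>

lemma exchange_eq_flipped:
  assumes "d \<in> T" "e \<notin> T" "triangulation n (insert e (T - {d}))"
  shows "e = flipped_diagonal n T d"
proof -
  obtain a b where d: "d = {a, b}" using assms T_subset diagonalE by (metis subsetD)
  then obtain a' b' where q: "quad a a' b b'" using assms quadE by metis
  interpret T': triangulated_polygon n "insert e (T - {d})"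
    using n assms by unfold_locales
  have "e = {a', b'}"
    using T'.T_not_crosses T'.T_subset assms d by (intro quad_exchange_only[OF q]) auto
  then show ?thesis using quad_flipped[OF q] d by simp
qed

lemma flip_back:
  assumes "d \<in> T"
  shows "flipped_diagonal n (flip n T d) (flipped_diagonal n T d) = d"
    "flip n (flip n T d) (flipped_diagonal n T d) = T"
proof -
  note f = flip_triangulation[OF assms]
  interpret T': triangulated_polygon n "flip n T d"
    using n f by unfold_locales
  have ne: "d \<noteq> flipped_diagonal n T d" using f assms by auto
  have eq: "insert d (flip n T d - {flipped_diagonal n T d}) = T"
    using f assms by (auto simp: flip_def)
  show *: "flipped_diagonal n (flip n T d) (flipped_diagonal n T d) = d"
    using T'.exchange_eq_flipped[of "flipped_diagonal n T d" d] eq T ne by (auto simp: flip_def)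
  show "flip n (flip n T d) (flipped_diagonal n T d) = T"
    using * eq by (simp add: flip_def[of n "flip n T d"])
qed

lemma card_flip:
  assumes "d \<in> T"
  shows "card (flip n T d) = card T"
proof -
  have "card (flip n T d) = Suc (card (T - {d}))"
    using flip_triangulation(4)[OF assms] T_finite by (simp add: flip_def)
  also have "\<dots> = card T" using card.remove[OF T_finite assms] by simp
  finally show ?thesis .
qed

lemma flip_inj:
  assumes "d \<in> T" "e \<in> T" "flip n T d = flip n T e"
  shows "d = e"
proof -
  have "T - flip n T d = {d}" if "d \<in> T" for d
    using that flip_triangulation(4)[OF that] by (auto simp: flip_def)
  then have "{d} = {e}" using assms by metis
  then show ?thesis by simp
qed

text \<open>Among the diagonals crossing \<open>{v, x}\<close>, the one closest to \<open>v\<close> spans a triangle with \<open>v\<close>, and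
  its flip ends at \<open>v\<close>.\<close>

lemma degree_increasing_flip:
  assumes v: "{v, x} \<in> diagonals n" "{v, x} \<notin> T"
  obtains d where "d \<in> T" "v \<notin> d" "v \<in> flipped_diagonal n T d"
proof -
  have V: "v \<in> {1..n}" "x \<in> {1..n}" "v \<noteq> x" "\<not> edge v x"
    using v by (auto simp: diagonal_iff edge_def)
  \<comment> \<open>\<open>r\<close> unrolls the labels from \<open>v\<close>. Members of
    \<open>C\<close> are oriented as \<open>v, p, x, q\<close>, and a maximal span \<open>g\<close>
    means closest to \<open>v\<close>.\<close>
  define r where "r w = (if w > v then w else w + n)" for w
  define C where "C = {(p, q). {p, q} \<in> T \<and> cyc v p x \<and> cyc x q v}"
  define g :: "nat \<times> nat \<Rightarrow> nat" where "g = (\<lambda>(p, q). r q - r p)"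
  have "C \<subseteq> {1..n} \<times> {1..n}" using edge_vertex by (fastforce simp: C_def edge_def)
  then have "finite C" by (rule finite_subset) simp
  moreover have "C \<noteq> {}"
  proof -
    obtain p q where "{p, q} \<in> T" "cyc v p x" "cyc x q v" using not_edge_cross[OF V] .
    then show ?thesis by (auto simp: C_def)
  qed
  ultimately obtain c where c: "c \<in> C" "\<And>c'. c' \<in> C \<Longrightarrow> g c' \<le> g c"
    using finite_attains_max[of C g] by blast
  obtain p q where pq: "c = (p, q)" "{p, q} \<in> T" "cyc v p x" "cyc x q v"
    using c by (auto simp: C_def)
  then have "{q, p} \<in> T" by (simp add: insert_commute)
  then obtain z y where quad: "quad q z p y" using quadE by metis
  then have z: "cyc q z p" "edge q z" "edge z p" by (auto simp: quad_def)
  have Vz: "p \<in> {1..n}" "q \<in> {1..n}" "z \<in> {1..n}" using z edge_vertex by blast+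
  \<comment> \<open>Otherwise \<open>{z, q}\<close> or \<open>{p, z}\<close> crosses
    \<open>{v, x}\<close>, hence lies in \<open>T\<close>, and has a larger span than
    \<open>{p, q}\<close>.\<close>
  have "z = v"
  proof (rule ccontr)
    assume "z \<noteq> v"
    then consider "cyc v z p" | "cyc q z v" using z pq unfolding cyc_def by linarith
    then show False
    proof cases
      case 1
      then have a: "cyc v z x" using pq unfolding cyc_def by linarith
      have "edge z q" using z edge_commute by simp
      then have "{z, q} \<in> T"
        using edge_crosses_imp[OF _ v(1), of z q] a pq unfolding crosses_iff by blast
      then have "(z, q) \<in> C" using a pq by (simp add: C_def)
      then have "g (z, q) \<le> g c" using c by simp
      then show False using 1 pq Vz V unfolding g_def r_def cyc_def by (auto split: if_splits)
    next
      case 2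
      then have a: "cyc x z v" using pq unfolding cyc_def by linarith
      have "edge p z" using z edge_commute by simp
      then have "{p, z} \<in> T"
        using edge_crosses_imp[OF _ v(1), of p z] a pq unfolding crosses_iff by blast
      then have "(p, z) \<in> C" using a pq by (simp add: C_def)
      then have "g (p, z) \<le> g c" using c by simp
      then show False using 2 pq Vz V unfolding g_def r_def cyc_def by (auto split: if_splits)
    qed
  qed
  then have "v \<in> flipped_diagonal n T {q, p}" using quad_flipped[OF quad] by simp
  moreover have "v \<notin> {q, p}" using pq by (auto simp: cyc_def)
  ultimately show ?thesis using that \<open>{q, p} \<in> T\<close> by blast
qed

end

section \<open>Flips towards a fan\<close>

definition fan :: "nat \<Rightarrow> nat \<Rightarrow> nat set set" where
  "fan n v = {d \<in> diagonals n. v \<in> d}"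

context triangulated_polygon
begin

text \<open>A diagonal avoiding \<open>v\<close> separates \<open>v\<close> from some vertex
  \<open>x\<close>, so it would cross the fan diagonal \<open>{v, x}\<close>.\<close>

lemma fan_subset_imp_eq:
  assumes "fan n v \<subseteq> T" "v \<in> {1..n}"
  shows "T = fan n v"
proof (rule equalityI[OF subsetI assms(1)])
  fix d assume d: "d \<in> T"
  obtain a b where ab: "d = {a, b}" "a \<in> {1..n}" "b \<in> {1..n}" "a \<noteq> b"
    using d T_subset diagonalE by (metis subsetD)
  have D: "{a, b} \<in> diagonals n" "{b, a} \<in> diagonals n"
    using d ab T_subset by (auto simp: insert_commute)
  show "d \<in> fan n v"
  proof (rule ccontr)
    assume "d \<notin> fan n v"
    then have "v \<noteq> a" "v \<noteq> b" using d ab T_subset by (auto simp: fan_def)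
    then have "cyc a v b \<or> cyc b v a" using ab unfolding cyc_def by linarith
    then obtain x where x: "x \<in> {1..n}" "cyc a v b \<and> cyc b x a \<or> cyc b v a \<and> cyc a x b"
      using diagonal_cyc D by metis
    have "{v, x} \<in> diagonals n"
    proof -
      have "cyc v b x \<and> cyc x a v \<or> cyc v a x \<and> cyc x b v" using x(2) unfolding cyc_def by linarith
      then show ?thesis using crosses_diagonal ab x assms(2) by metis
    qed
    then have "{v, x} \<in> T" using assms(1) by (auto simp: fan_def)
    then show False using T_not_crosses[OF d, of "{v, x}"] x(2) by (auto simp: ab crosses_iff)
  qed
qed

text \<open>The number of missing fan diagonals is the measure for reaching the fan: the flip adds a
  diagonal at \<open>v\<close> and removes one that avoids \<open>v\<close>.\<close>

lemma flip_towards_fan: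
  assumes "v \<in> {1..n}" "T \<noteq> fan n v"
  obtains d where "d \<in> T" "flipped_diagonal n T d \<in> fan n v"
    "card (fan n v - flip n T d) < card (fan n v - T)"
proof -
  obtain e where e: "e \<in> fan n v" "e \<notin> T" using fan_subset_imp_eq assms by blast
  then obtain x where "e = {v, x}" by (auto simp: fan_def elim!: diagonalE)
  then obtain d where d: "d \<in> T" "v \<notin> d" "v \<in> flipped_diagonal n T d"
    using degree_increasing_flip e by (auto simp: fan_def)
  note f = flip_triangulation[OF d(1)]
  have F: "flipped_diagonal n T d \<in> fan n v" using f d by (simp add: fan_def)
  have "fan n v - flip n T d \<subset> fan n v - T"
    using F f(4) d(2) by (auto simp: flip_def fan_def)
  moreover have "finite (fan n v - T)" using finite_diagonals by (simp add: fan_def)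
  ultimately show ?thesis using that d(1) F psubset_card_mono by blast
qed

end

text \<open>Both flips would take place in the same quadrilateral. Disjointness forces its four sides
  to be sides of the polygon, so that it would be the whole polygon.\<close>

lemma no_mutual_flip:
  assumes n: "n \<ge> 5" and T: "triangulation n T" and U: "triangulation n U" and "T \<inter> U = {}"
    and d: "d \<in> T" "flipped_diagonal n T d \<in> U"
      "flipped_diagonal n U (flipped_diagonal n T d) = d"
  shows False
proof -
  interpret T: triangulated_polygon n T using n T by unfold_locales auto
  interpret U: triangulated_polygon n U using n U by unfold_locales auto
  obtain a b where ab: "d = {a, b}" using d T.T_subset diagonalE by (metis subsetD)
  then obtain a' b' where q: "T.quad a a' b b'" using d T.quadE by metis
  then have f: "flipped_diagonal n T d = {a', b'}" using T.quad_flipped ab by simp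
  then obtain c c' where q': "U.quad a' c b' c'" using d U.quadE by metis
  then have "{c, c'} = {a, b}" using U.quad_flipped d f ab by simp
  then have "c = a \<and> c' = b \<or> c = b \<and> c' = a" by (auto simp: doubleton_eq_iff)
  then have U: "U.edge a a'" "U.edge a' b" "U.edge b b'" "U.edge b' a"
    using q' U.edge_commute by (auto simp: U.quad_def)
  have "{a, a'} \<in> sides n" "{a', b} \<in> sides n" "{b, b'} \<in> sides n" "{b', a} \<in> sides n"
    using U q \<open>T \<inter> U = {}\<close> unfolding T.quad_def T.edge_def U.edge_def by blast+
  moreover have "cyc a a' b" "cyc a' b b'" "cyc b b' a" "cyc b' a a'"
    using q unfolding T.quad_def cyc_def by linarith+
  moreover have "a \<in> {1..n}" "a' \<in> {1..n}" "b \<in> {1..n}" "b' \<in> {1..n}"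
    using U U.edge_vertex by blast+
  \<comment> \<open>Each side leads to the next vertex, with 1 following \<open>n\<close>; four such
    steps cannot close up when \<open>n\<close> is at least 5.\<close>
  ultimately have "a = n \<and> a' = 1 \<or> a' = a + 1" "a' = n \<and> b = 1 \<or> b = a' + 1"
    "b = n \<and> b' = 1 \<or> b' = b + 1" "b' = n \<and> a = 1 \<or> a = b' + 1"
    using side_successor by blast+
  then show False using n by linarith
qed


section \<open>Pairs of disjoint triangulations\<close>

lemma disjoint_pairs_iff:
  "(T, U) \<in> disjoint_pairs n \<longleftrightarrow> triangulation n T \<and> triangulation n U \<and> T \<inter> U = {}"
  by (simp add: disjoint_pairs_def)

lemma finite_disjoint_pairs: "finite (disjoint_pairs n)"
proof (rule finite_subset)
  show "disjoint_pairs n \<subseteq> Pow (diagonals n) \<times> Pow (diagonals n)"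
    by (auto simp: disjoint_pairs_def triangulation_def)
qed (simp add: finite_diagonals)

lemma swap_disjoint_pairs: "prod.swap P \<in> disjoint_pairs n \<longleftrightarrow> P \<in> disjoint_pairs n"
  by (cases P) (auto simp: disjoint_pairs_iff)

lemma joint_flip_single:
  "flipped_diagonal n T d \<notin> U \<Longrightarrow> joint_flip n T U d = (flip n T d, U)"
  by (simp add: joint_flip_def Let_def)

lemma joint_flip_double:
  "flipped_diagonal n T d \<in> U \<Longrightarrow>
    joint_flip n T U d = (flip n T d, flip n U (flipped_diagonal n T d))"
  by (simp add: joint_flip_def Let_def)

lemma obtained_by_flip_swap:
  "obtained_by_flip n (prod.swap P) (prod.swap Q) \<longleftrightarrow> obtained_by_flip n P Q"
proof -
  have "prod.swap Q = x \<longleftrightarrow> Q = prod.swap x" for x :: triangulation_pair by (metis swap_swap)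
  moreover have "prod.swap Q = prod.swap x \<longleftrightarrow> Q = x" for x :: triangulation_pair
    by (metis swap_swap)
  ultimately show ?thesis by (auto simp: obtained_by_flip_def)
qed

section \<open>Joint flips: disjointness, reversal and distinctness\<close>

locale polygon_pair =
  fixes n :: nat and T U :: "nat set set"
  assumes n: "n \<ge> 5" and pair: "(T, U) \<in> disjoint_pairs n"

sublocale polygon_pair \<subseteq> T: triangulated_polygon n T
  using n pair by unfold_locales (auto simp: disjoint_pairs_iff)

sublocale polygon_pair \<subseteq> U: triangulated_polygon n U
  using n pair by unfold_locales (auto simp: disjoint_pairs_iff)

context polygon_pair
begin

lemma disjoint: "T \<inter> U = {}"
  using pair by (simp add: disjoint_pairs_iff)

lemma joint_flip_disjoint_pair:
  assumes d: "d \<in> T"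
  shows "joint_flip n T U d \<in> disjoint_pairs n"
proof (cases "flipped_diagonal n T d \<in> U")
  case False
  have "flip n T d \<inter> U = {}" using False disjoint by (auto simp: flip_def)
  then show ?thesis
    using False T.flip_triangulation(1)[OF d] U.T
    by (simp add: joint_flip_single disjoint_pairs_iff)
next
  case True
  let ?e = "flipped_diagonal n T d" and ?f = "flipped_diagonal n U (flipped_diagonal n T d)"
  have c: "crosses ?e ?f" and "triangulation n (flip n U ?e)" using U.flip_triangulation[OF True] by auto
  have T': "triangulation n (flip n T d)" using T.flip_triangulation[OF d] by blast
  interpret T': triangulated_polygon n "flip n T d" using T' T.n by unfold_locales
  \<comment> \<open>The diagonals newly added to the two triangulations cross each other, so they
    cannot lie in a common triangulation.\<close>
  have "?f \<notin> flip n T d" using c T'.T_not_crosses[of ?e ?f] by (auto simp: flip_def)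
  then have "flip n T d \<inter> flip n U ?e = {}"
    using disjoint by (auto simp: flip_def)
  then show ?thesis
    using True T' \<open>triangulation n (flip n U ?e)\<close>
    by (simp add: joint_flip_double disjoint_pairs_iff)
qed

text \<open>A single flip is undone in the same component, since \<open>d\<close> is not in
  \<open>U\<close>. A double flip is undone from the other component: flipping \<open>?f\<close>
  brings back \<open>?e\<close>, which induces the return to \<open>d\<close>.\<close>

lemma obtained_by_flip_back:
  assumes d: "d \<in> T"
  shows "obtained_by_flip n (joint_flip n T U d) (T, U)"
proof (cases "flipped_diagonal n T d \<in> U")
  case False
  have "flipped_diagonal n T d \<in> flip n T d" by (simp add: flip_def)
  moreover have "joint_flip n (flip n T d) U (flipped_diagonal n T d) = (T, U)"
    using T.flip_back[OF d] d disjoint by (subst joint_flip_single) auto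
  ultimately show ?thesis
    unfolding obtained_by_flip_def joint_flip_single[OF False]
    by (intro disjI1 bexI[of _ "flipped_diagonal n T d"]) auto
next
  case True
  let ?e = "flipped_diagonal n T d" and ?f = "flipped_diagonal n U (flipped_diagonal n T d)"
  have f: "?f \<in> flip n U ?e" and e: "?e \<in> flip n T d" by (simp_all add: flip_def)
  have "joint_flip n (flip n U ?e) (flip n T d) ?f = (U, T)"
    using U.flip_back[OF True] T.flip_back[OF d] e by (subst joint_flip_double) auto
  then show ?thesis
    unfolding obtained_by_flip_def joint_flip_double[OF True] using f
    by (intro disjI2 bexI[of _ ?f]) auto
qed

lemma joint_flip_inj: "inj_on (joint_flip n T U) T"
proof (rule inj_onI)
  fix d e assume "d \<in> T" "e \<in> T" "joint_flip n T U d = joint_flip n T U e"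
  then show "d = e" using T.flip_inj by (simp add: joint_flip_def Let_def)
qed

text \<open>Both components would change, so each flip would induce the other, which
  \<open>no_mutual_flip\<close> excludes.\<close>

lemma joint_flips_distinct:
  assumes d: "d \<in> T" and e: "e \<in> U"
  shows "joint_flip n T U d \<noteq> prod.swap (joint_flip n U T e)"
proof
  assume eq: "joint_flip n T U d = prod.swap (joint_flip n U T e)"
  have changed: "flip n T d \<noteq> T" "flip n U e \<noteq> U"
    using T.flip_triangulation(4)[OF d] U.flip_triangulation(4)[OF e] by (auto simp: flip_def)
  define d' e' where "d' = flipped_diagonal n T d" and "e' = flipped_diagonal n U e"
  have 1: "flip n T d = (if e' \<in> T then flip n T e' else T)"
    using arg_cong[OF eq, of fst] by (simp add: joint_flip_def Let_def e'_def)
  have "(if d' \<in> U then flip n U d' else U) = flip n U e"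
    using arg_cong[OF eq, of snd] by (simp only: joint_flip_def Let_def d'_def swap_simp snd_conv)
  note 2 = this[symmetric]
  have "e' \<in> T" "d' \<in> U" using 1 2 changed by metis+
  then have "d = e'" "e = d'" using 1 2 d e T.flip_inj U.flip_inj by simp_all
  then show False
    using no_mutual_flip[OF n T.T U.T disjoint d] e by (simp add: d'_def e'_def)
qed

end

lemma obtained_by_flip_imp:
  assumes n: "n \<ge> 5" and P: "P \<in> disjoint_pairs n" and Q: "obtained_by_flip n P Q"
  shows "Q \<in> disjoint_pairs n \<and> obtained_by_flip n Q P"
proof -
  obtain T U where TU: "P = (T, U)" by fastforce
  interpret P: polygon_pair n T U using n P TU by unfold_locales simp_all
  interpret S: polygon_pair n U T
    using n P TU swap_disjoint_pairs[of P n] by unfold_locales simp_all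
  consider d where "d \<in> T" "Q = joint_flip n T U d"
    | d where "d \<in> U" "Q = prod.swap (joint_flip n U T d)"
    using Q by (auto simp: obtained_by_flip_def TU)
  then show ?thesis
  proof cases
    case 1
    then show ?thesis using P.joint_flip_disjoint_pair P.obtained_by_flip_back TU by simp
  next
    case 2
    then have "prod.swap Q \<in> disjoint_pairs n" "obtained_by_flip n (prod.swap Q) (prod.swap P)"
      using S.joint_flip_disjoint_pair S.obtained_by_flip_back TU by simp_all
    then show ?thesis by (simp add: swap_disjoint_pairs obtained_by_flip_swap)
  qed
qed

section \<open>Degrees in the flip graph\<close>

lemma neighbours_eq:
  assumes n: "n \<ge> 5" and P: "(T, U) \<in> disjoint_pairs n"
  shows "neighbours n (T, U) = joint_flip n T U ` T \<union> (prod.swap \<circ> joint_flip n U T) ` U"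
proof -
  have "neighbours n (T, U) = {Q. obtained_by_flip n (T, U) Q}"
    using obtained_by_flip_imp[OF n] P unfolding neighbours_def adjacent_def by blast
  then show ?thesis by (auto simp: obtained_by_flip_def)
qed

lemma card_neighbours:
  assumes n: "n \<ge> 5" and P: "(T, U) \<in> disjoint_pairs n"
  shows "card (neighbours n (T, U)) = card T + card U"
proof -
  interpret P: polygon_pair n T U using n P by unfold_locales
  interpret S: polygon_pair n U T
    using n P swap_disjoint_pairs[of "(T, U)" n] by unfold_locales simp_all
  let ?A = "joint_flip n T U ` T" and ?B = "(prod.swap \<circ> joint_flip n U T) ` U"
  have "inj_on (prod.swap \<circ> joint_flip n U T) U"
    using S.joint_flip_inj by (intro comp_inj_on) auto
  then have "card ?A = card T" "card ?B = card U"
    using P.joint_flip_inj by (simp_all only: card_image)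
  moreover have "?A \<inter> ?B = {}"
    using P.joint_flips_distinct unfolding comp_def by blast
  ultimately show ?thesis
    using P.T.T_finite P.U.T_finite unfolding neighbours_eq[OF n P]
    by (subst card_Un_disjoint) simp_all
qed

lemma adjacent_card_eq:
  assumes n: "n \<ge> 5" and PQ: "adjacent n P Q"
  shows "card (fst Q) + card (snd Q) = card (fst P) + card (snd P)"
proof -
  have step: "card (fst (joint_flip n T U d)) + card (snd (joint_flip n T U d)) = card T + card U"
    if "(T, U) \<in> disjoint_pairs n" "d \<in> T" for T U d
  proof -
    interpret polygon_pair n T U using n that by unfold_locales
    show ?thesis using that(2) T.card_flip U.card_flip by (simp add: joint_flip_def Let_def)
  qed
  have P: "P \<in> disjoint_pairs n" using PQ by (simp add: adjacent_def)
  obtain T U where TU: "P = (T, U)" by fastforce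
  have Q: "Q \<in> neighbours n (T, U)" using PQ TU by (simp add: neighbours_def)
  have P': "(T, U) \<in> disjoint_pairs n" "(U, T) \<in> disjoint_pairs n"
    using P TU swap_disjoint_pairs[of P n] by simp_all
  then show ?thesis using Q step unfolding neighbours_eq[OF n P'(1)] TU
    by (auto simp: add.commute)
qed

lemma adjacent_sym: "adjacent n P Q \<Longrightarrow> adjacent n Q P"
  by (auto simp: adjacent_def)

lemma adjacent_flip_fst:
  assumes n: "n \<ge> 5" and P: "(T, U) \<in> disjoint_pairs n" and d: "d \<in> T"
  shows "adjacent n (T, U) (joint_flip n T U d)"
  using neighbours_eq[OF n P] d by (auto simp: neighbours_def)

lemma adjacent_flip_snd:
  assumes n: "n \<ge> 5" and P: "(T, U) \<in> disjoint_pairs n" and d: "d \<in> U"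
  shows "adjacent n (T, U) (prod.swap (joint_flip n U T d))"
  using neighbours_eq[OF n P] d by (auto simp: neighbours_def)

section \<open>Connectedness through the pair of fans\<close>

abbreviation flip_graph :: "nat \<Rightarrow> triangulation_pair rel" where
  "flip_graph n \<equiv> {(P, Q). adjacent n P Q}"

text \<open>Induced flips may alter the second triangulation in an uncontrolled way, but the measure
  depends on the first one only.\<close>

lemma reach_fan_fst:
  assumes n: "n \<ge> 5" and v: "v \<in> {1..n}" and P: "(T, U) \<in> disjoint_pairs n"
  shows "\<exists>U'. (fan n v, U') \<in> disjoint_pairs n \<and> ((T, U), (fan n v, U')) \<in> (flip_graph n)\<^sup>*"
  using P
proof (induction "card (fan n v - T)" arbitrary: T U rule: less_induct)
  case less
  interpret polygon_pair n T U using n less.prems by unfold_locales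
  show ?case
  proof (cases "T = fan n v")
    case True
    then show ?thesis using less.prems by blast
  next
    case False
    then obtain d where d: "d \<in> T" "card (fan n v - flip n T d) < card (fan n v - T)"
      using T.flip_towards_fan[OF v] by blast
    obtain U' where U': "joint_flip n T U d = (flip n T d, U')"
      by (auto simp: joint_flip_def Let_def)
    then have adj: "adjacent n (T, U) (flip n T d, U')"
      using adjacent_flip_fst[OF n less.prems d(1)] by simp
    then have "(flip n T d, U') \<in> disjoint_pairs n" by (simp add: adjacent_def)
    then obtain U'' where "(fan n v, U'') \<in> disjoint_pairs n"
      "((flip n T d, U'), (fan n v, U'')) \<in> (flip_graph n)\<^sup>*"
      using less.hyps d(2) by blast
    then show ?thesis using adj by (blast intro: converse_rtrancl_into_rtrancl)
  qed
qed

text \<open>The only segment that two fans at neighbouring vertices could share is a side, so moving the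
  second triangulation towards its fan never disturbs the first.\<close>

lemma reach_fan_snd:
  assumes n: "n \<ge> 5" and vw: "{v, w} \<in> sides n" and P: "(fan n v, U) \<in> disjoint_pairs n"
  shows "((fan n v, U), (fan n v, fan n w)) \<in> (flip_graph n)\<^sup>*"
  using P
proof (induction "card (fan n w - U)" arbitrary: U rule: less_induct)
  case less
  interpret polygon_pair n "fan n v" U using n less.prems by unfold_locales
  have w: "w \<in> {1..n}" and "v \<noteq> w" using vw n by (auto simp: side_iff)
  show ?case
  proof (cases "U = fan n w")
    case False
    then obtain d where d: "d \<in> U" "flipped_diagonal n U d \<in> fan n w"
      "card (fan n w - flip n U d) < card (fan n w - U)"
      using U.flip_towards_fan[OF w] by blast
    have "flipped_diagonal n U d \<notin> fan n v"
    proof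
      assume "flipped_diagonal n U d \<in> fan n v"
      then have "{v, w} \<subseteq> flipped_diagonal n U d" "flipped_diagonal n U d \<in> diagonals n"
        using d by (auto simp: fan_def)
      moreover obtain a b where "flipped_diagonal n U d = {a, b}"
        using diagonalE[OF calculation(2)] by metis
      ultimately have "flipped_diagonal n U d = {v, w}" using \<open>v \<noteq> w\<close> by auto
      then have "{v, w} \<in> diagonals n"
        using \<open>flipped_diagonal n U d \<in> diagonals n\<close> by simp
      then show False using vw by (simp add: diagonal_iff)
    qed
    then have adj: "adjacent n (fan n v, U) (fan n v, flip n U d)"
      using adjacent_flip_snd[OF n less.prems d(1)] by (simp add: joint_flip_single)
    then have "(fan n v, flip n U d) \<in> disjoint_pairs n" by (simp add: adjacent_def)
    then have "((fan n v, flip n U d), (fan n v, fan n w)) \<in> (flip_graph n)\<^sup>*"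
      using less.hyps d(3) by blast
    then show ?thesis using adj by (blast intro: converse_rtrancl_into_rtrancl)
  qed simp
qed

section \<open>A triangle in the flip graph\<close>

lemma double_flip_triangle:
  assumes n: "n \<ge> 5" and P: "(T, U) \<in> disjoint_pairs n"
    and d: "d \<in> U" "flipped_diagonal n U d \<in> T"
  shows "((T, U), (T, U)) \<in> flip_graph n ^^ 3"
proof -
  interpret polygon_pair n T U using n P by unfold_locales
  define e where "e = flipped_diagonal n U d"
  have e: "e \<in> T" using d by (simp add: e_def)
  let ?R = "(flip n T e, flip n U d)" and ?Q = "(flip n T e, U)"
  have PR: "adjacent n (T, U) ?R"
    using adjacent_flip_snd[OF n P d(1)] d(2) by (simp add: joint_flip_double e_def)
  \<comment> \<open>A member of \<open>U\<close> crossing \<open>e\<close> can only be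
    \<open>d\<close>, and then the flips at \<open>d\<close> and \<open>e\<close> would be
    mutual.\<close>
  have "flipped_diagonal n T e \<notin> U"
  proof
    assume *: "flipped_diagonal n T e \<in> U"
    have "crosses (flipped_diagonal n T e) e"
      using T.flip_triangulation(3)[OF e] crosses_commute by blast
    then have "flipped_diagonal n T e = d"
      using U.flip_triangulation(5)[OF d(1) *] by (simp add: e_def)
    then show False
      using no_mutual_flip[OF n T.T U.T disjoint e] d(1) by (simp add: e_def)
  qed
  then have PQ: "adjacent n (T, U) ?Q"
    using adjacent_flip_fst[OF n P e] by (simp add: joint_flip_single)
  then have Q: "?Q \<in> disjoint_pairs n" by (simp add: adjacent_def)
  \<comment> \<open>Once \<open>e\<close> has left the first triangulation, the flip of
    \<open>d\<close> in \<open>U\<close> induces no second flip.\<close>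
  have "e \<notin> flip n T e"
    using T.flip_triangulation(4)[OF e] e by (auto simp: flip_def)
  then have QR: "adjacent n ?Q ?R"
    using adjacent_flip_snd[OF n Q d(1)] by (simp add: joint_flip_single e_def)
  have "((T, U), (T, U)) \<in> flip_graph n O flip_graph n O flip_graph n"
    using PQ QR adjacent_sym[OF PR] by blast
  then show ?thesis by (simp add: numeral_3_eq_3 O_assoc)
qed

text \<open>The diagonal \<open>{2, n}\<close> cuts off the vertex 1 alone, so whatever crosses it
  ends at 1.\<close>

lemma fans_double_flip:
  assumes n: "n \<ge> 5" and P: "(fan n 1, fan n 2) \<in> disjoint_pairs n"
  shows "{2, n} \<in> fan n 2" "flipped_diagonal n (fan n 2) {2, n} \<in> fan n 1"
proof -
  interpret polygon_pair n "fan n 1" "fan n 2" using n P by unfold_locales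
  show d: "{2, n} \<in> fan n 2" using n by (auto simp: fan_def diagonal_iff side_iff)
  let ?e = "flipped_diagonal n (fan n 2) {2, n}"
  note f = U.flip_triangulation[OF d]
  obtain x y where xy: "?e = {x, y}" "x \<in> {1..n}" "y \<in> {1..n}" using f(2) by (auto elim: diagonalE)
  have "cyc 2 x n \<and> cyc n y 2 \<or> cyc 2 y n \<and> cyc n x 2"
    using f(3) unfolding xy crosses_iff .
  then have "x = 1 \<or> y = 1" using xy(2,3) n by (auto simp: cyc_def)
  then show "?e \<in> fan n 1" using f(2) xy by (auto simp: fan_def)
qed

theorem theorem1p2:
  fixes n :: nat and M :: "'w measure" and X :: "nat \<Rightarrow> 'w \<Rightarrow> triangulation_pair"
    and P :: triangulation_pair
  assumes "n \<ge> 5"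
    and "P \<in> disjoint_pairs n"
    and "markov_chain M (disjoint_pairs n) (\<lambda>Q. pmf_of_set (neighbours n Q)) X"
    and "AE \<omega> in M. X 0 \<omega> = P"
  shows "(\<lambda>t. total_variation (distr M (count_space (disjoint_pairs n)) (X t))
                (uniform_count_measure (disjoint_pairs n))) \<longlonglongrightarrow> 0"
proof -
  note n = \<open>n \<ge> 5\<close>
  define c where "c = (fan n 1, fan n 2)"
  define D where "D = card (fst c) + card (snd c)"
  have hub: "(Q, c) \<in> (flip_graph n)\<^sup>*" if Q: "Q \<in> disjoint_pairs n" for Q
  proof -
    obtain T U where TU: "Q = (T, U)" by fastforce
    obtain U' where U': "(fan n 1, U') \<in> disjoint_pairs n" "(Q, (fan n 1, U')) \<in> (flip_graph n)\<^sup>*"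
      using reach_fan_fst[OF n, of 1 T U] n Q unfolding TU by auto
    have "((fan n 1, U'), c) \<in> (flip_graph n)\<^sup>*"
      unfolding c_def using reach_fan_snd[OF n _ U'(1), of 2] n by (auto simp: side_iff)
    then show ?thesis using U'(2) by (rule rtrancl_trans[rotated])
  qed
  \<comment> \<open>That the two fans form a vertex of the graph follows from reaching them by flips
    from the vertex \<open>P\<close>.\<close>
  have c: "c \<in> disjoint_pairs n"
    using hub[OF assms(2)] assms(2) by (induction rule: rtrancl_induct) (auto simp: adjacent_def)
  note double = fans_double_flip[OF n c[unfolded c_def]]
  have c3: "(c, c) \<in> flip_graph n ^^ 3"
    using double_flip_triangle[OF n c[unfolded c_def] double] by (simp add: c_def)
  obtain Q where "adjacent n c Q"
    using adjacent_flip_snd[OF n c[unfolded c_def] double(1)] by (auto simp: c_def)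
  then have "(c, Q) \<in> flip_graph n" "(Q, c) \<in> flip_graph n" using adjacent_sym by simp_all
  then have c2: "(c, c) \<in> flip_graph n ^^ 2" by (auto simp: numeral_2_eq_2)
  \<comment> \<open>The total number of diagonals is constant along a walk to \<open>c\<close>,
    which makes the graph regular of degree \<open>D\<close>.\<close>
  have "card (fst c) + card (snd c) = card (fst Q) + card (snd Q)" if "Q \<in> disjoint_pairs n" for Q
    using hub[OF that] by (induction rule: rtrancl_induct) (use adjacent_card_eq[OF n] in auto)
  then have card: "card (neighbours n Q) = D" if "Q \<in> disjoint_pairs n" for Q
    using that card_neighbours[OF n, of "fst Q" "snd Q"] by (simp add: D_def)
  have "sym (flip_graph n)" by (auto intro: symI adjacent_sym)
  then obtain L where L: "\<And>Q R. Q \<in> disjoint_pairs n \<Longrightarrow> R \<in> disjoint_pairs n \<Longrightarrow>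
      (Q, R) \<in> flip_graph n ^^ L"
    using exact_length_walks[OF finite_disjoint_pairs _ hub c2 c3] by blast
  have graph: "flip_graph n = {(Q, R). Q \<in> disjoint_pairs n \<and> R \<in> neighbours n Q}"
    by (auto simp: neighbours_def adjacent_def)
  show ?thesis
  proof (rule random_walk_regular_graph_converges[OF finite_disjoint_pairs _ card _ _ _ assms(3)])
    show "D > 0"
      using double(1) finite_diagonals by (auto simp: D_def c_def card_gt_0_iff fan_def)
    show "neighbours n Q \<subseteq> disjoint_pairs n" for Q
      by (auto simp: neighbours_def adjacent_def)
    show "Q \<in> neighbours n R" if "R \<in> neighbours n Q" for Q R
      using that adjacent_sym by (simp add: neighbours_def)
    show "(Q, R) \<in> {(Q, R). Q \<in> disjoint_pairs n \<and> R \<in> neighbours n Q} ^^ L"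
      if "Q \<in> disjoint_pairs n" "R \<in> disjoint_pairs n" for Q R
      using L that graph by simp
  qed
qed

end
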